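(* Let $\mathcal V$ be a braided monoidal category, let $\mathcal C,\mathcal D,\mathcal E$ be $\mathcal V$-monoidal categories, let $\mathcal F,\mathcal G,\mathcal H:\mathcal C\to\mathcal D$ and $\mathcal I,\mathcal J,\mathcal K:\mathcal D\to\mathcal E$ be $\mathcal V$-functors, and let $\kappa:\mathcal F\Rightarrow\mathcal G$, $\lambda:\mathcal I\Rightarrow\mathcal J$, $\mu:\mathcal G\Rightarrow\mathcal H$, $\nu:\mathcal J\Rightarrow\mathcal K$ be natural transformations which are respectively $u$-, $v$-, $w$-, $x$-graded, for $u,v,w,x\in\mathcal V$. Then for every object $a\in\mathcal C$, $$((\kappa\lambda)\circ(\mu\nu))_a=(\mathbf 1_u\,\beta_{v,w}\,\mathbf 1_x)\circ((\kappa\circ\mu)(\lambda\circ\nu))_a:\ uvwx\to\mathcal E(\mathcal I(\mathcal F(a))\to\mathcal K(\mathcal H(a))),$$ where juxtaposition of natural transformations is horizontal composition and $\circ$ is vertical composition.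
   Context: Composition is written left to right ($f\circ g$: first $f$, then $g$; for functors, $(\mathcal F\circ\mathcal I)(a)=\mathcal I(\mathcal F(a))$). Tensor products in $\mathcal V$ are written by juxtaposition; unitors and associators are suppressed. $\beta_{u,v}:uv\to vu$ is the braiding of $\mathcal V$. A $\mathcal V$-enriched category $\mathcal C$ has hom objects $\mathcal C(a\to b)\in\mathcal V$, identity elements $j_a:1_{\mathcal V}\to\mathcal C(a\to a)$ and composition morphisms $(-\circ_{\mathcal C}-):\mathcal C(a\to b)\mathcal C(b\to c)\to\mathcal C(a\to c)$, which are associative and unital. A (strict) $\mathcal V$-monoidal category is a $\mathcal V$-enriched category with a unit object $1_{\mathcal C}$, objects $ab$, and morphisms $(-\otimes_{\mathcal C}-):\mathcal C(a\to c)\mathcal C(b\to d)\to\mathcal C(ab\to cd)$, strictly unital and associative on objects and morphisms, with $(j_aj_b)\circ(-\otimes_{\mathcal C}-)=j_{ab}$, and satisfying the braided interchange $((-\otimes_{\mathcal C}-)(-\otimes_{\mathcal C}-))\circ(-\circ_{\mathcal C}-)=(\mathbf 1\,\beta_{\mathcal C(d\to e),\mathcal C(b\to c)}\,\mathbf 1)\circ((-\circ_{\mathcal C}-)(-\circ_{\mathcal C}-))\circ(-\otimes_{\mathcal C}-)$ on $\mathcal C(a\to b)\mathcal C(d\to e)\mathcal C(b\to c)\mathcal C(e\to f)$. A $\mathcal V$-functor $\mathcal F:\mathcal C\to\mathcal D$ is a function on objects with morphisms $\mathcal F_{a\to b}:\mathcal C(a\to b)\to\mathcal D(\mathcal F(a)\to\mathcal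 F(b))$ in $\mathcal V$ such that $(-\circ_{\mathcal C}-)\circ\mathcal F_{a\to c}=(\mathcal F_{a\to b}\mathcal F_{b\to c})\circ(-\circ_{\mathcal D}-)$ and $j_a\circ\mathcal F_{a\to a}=j_{\mathcal F(a)}$. For $v\in\mathcal V$, a $v$-graded natural transformation $\lambda:\mathcal F\Rightarrow\mathcal G$ between $\mathcal V$-functors $\mathcal C\to\mathcal D$ is a family $\lambda_a:v\to\mathcal D(\mathcal F(a)\to\mathcal G(a))$ with $(\lambda_a\,\mathcal G_{a\to b})\circ(-\circ_{\mathcal D}-)=\beta_{v,\mathcal C(a\to b)}\circ(\mathcal F_{a\to b}\,\lambda_b)\circ(-\circ_{\mathcal D}-)$ as maps $v\,\mathcal C(a\to b)\to\mathcal D(\mathcal F(a)\to\mathcal G(b))$. Vertical composite: if $\lambda:\mathcal F\Rightarrow\mathcal G$ is $u$-graded and $\mu:\mathcal G\Rightarrow\mathcal H$ is $v$-graded, then $\lambda\circ\mu:\mathcal F\Rightarrow\mathcal H$ is the $uv$-graded transformation $(\lambda\circ\mu)_a=(\lambda_a\mu_a)\circ(-\circ_{\mathcal D}-)$. Horizontal composite: if $\kappa:\mathcal F\Rightarrow\mathcal G$ is $u$-graded between functors $\mathcal C\to\mathcal D$ and $\lambda:\mathcal I\Rightarrow\mathcal J$ is $v$-graded between functors $\mathcal D\to\mathcal E$, then $\kappa\lambda:\mathcal F\circ\mathcal I\Rightarrow\mathcal G\circ\mathcal J$ is the $uv$-graded transformation $(\kappa\lambda)_a=(\kappa_a\,\lambda_{\mathcal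 G(a)})\circ(\mathcal I_{\mathcal F(a)\to\mathcal G(a)}\,\mathbf 1)\circ(-\circ_{\mathcal E}-)$. *)

theory Defs
  imports Main
begin

section \<open>Braided monoidal categories\<close>

text \<open>
  Composition is written in diagrammatic order throughout: \<open>f \<Zsemi> g\<close> is first \<open>f\<close>, then \<open>g\<close>.
  Monoidal categories are not assumed strict: associators
  \<open>\<alpha> u v w : (u \<otimes> v) \<otimes> w \<rightarrow> u \<otimes> (v \<otimes> w)\<close> and unitors are part of the data and are written out
  in every formula below.
\<close>

record ('o, 'm) braided_data =
  Obj :: "'o set"
  Arr :: "'m set"
  Dom :: "'m \<Rightarrow> 'o"
  Cod :: "'m \<Rightarrow> 'o"
  ident :: "'o \<Rightarrow> 'm"  ("\<one>\<index>")
  seq :: "'m \<Rightarrow> 'm \<Rightarrow> 'm"  (infixl "\<Zsemi>\<index>" 65)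
  unit_obj :: 'o  ("\<I>\<index>")
  tensor_obj :: "'o \<Rightarrow> 'o \<Rightarrow> 'o"  (infixl "\<otimes>\<index>" 75)
  tensor_arr :: "'m \<Rightarrow> 'm \<Rightarrow> 'm"  (infixl "\<boxtimes>\<index>" 75)
  assoc :: "'o \<Rightarrow> 'o \<Rightarrow> 'o \<Rightarrow> 'm"  ("\<alpha>\<index>")
  lunit :: "'o \<Rightarrow> 'm"  ("\<l>\<index>")
  runit :: "'o \<Rightarrow> 'm"  ("\<r>\<index>")
  braid :: "'o \<Rightarrow> 'o \<Rightarrow> 'm"  ("\<beta>\<index>")

definition hom :: "('o, 'm, 'z) braided_data_scheme \<Rightarrow> 'o \<Rightarrow> 'o \<Rightarrow> 'm set"  ("hom\<index>") where
  "hom\<^bsub>V\<^esub> u v = {f \<in> Arr V. Dom V f = u \<and> Cod V f = v}"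

definition inverse_arrows :: "('o, 'm, 'z) braided_data_scheme \<Rightarrow> 'm \<Rightarrow> 'm \<Rightarrow> bool" where
  "inverse_arrows V f g \<longleftrightarrow>
     f \<in> Arr V \<and> g \<in> hom\<^bsub>V\<^esub> (Cod V f) (Dom V f) \<and>
     f \<Zsemi>\<^bsub>V\<^esub> g = \<one>\<^bsub>V\<^esub> (Dom V f) \<and> g \<Zsemi>\<^bsub>V\<^esub> f = \<one>\<^bsub>V\<^esub> (Cod V f)"

definition iso :: "('o, 'm, 'z) braided_data_scheme \<Rightarrow> 'm \<Rightarrow> bool"  ("iso\<index>") where
  "iso\<^bsub>V\<^esub> f \<longleftrightarrow> (\<exists>g. inverse_arrows V f g)"

definition inverse_arr :: "('o, 'm, 'z) braided_data_scheme \<Rightarrow> 'm \<Rightarrow> 'm"  ("inv\<index>") where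
  "inv\<^bsub>V\<^esub> f = (THE g. inverse_arrows V f g)"

locale category =
  fixes V :: "('o, 'm, 'z) braided_data_scheme" (structure)
  assumes Dom_Obj: "f \<in> Arr V \<Longrightarrow> Dom V f \<in> Obj V"
    and Cod_Obj: "f \<in> Arr V \<Longrightarrow> Cod V f \<in> Obj V"
    and ident_hom: "u \<in> Obj V \<Longrightarrow> \<one> u \<in> hom u u"
    and seq_hom: "\<lbrakk>f \<in> hom u v; g \<in> hom v w\<rbrakk> \<Longrightarrow> f \<Zsemi> g \<in> hom u w"
    and ident_seq: "f \<in> hom u v \<Longrightarrow> \<one> u \<Zsemi> f = f"
    and seq_ident: "f \<in> hom u v \<Longrightarrow> f \<Zsemi> \<one> v = f"
    and seq_assoc: "\<lbrakk>f \<in> hom u v; g \<in> hom v w; h \<in> hom w x\<rbrakk>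
          \<Longrightarrow> (f \<Zsemi> g) \<Zsemi> h = f \<Zsemi> (g \<Zsemi> h)"

locale monoidal_category = category +
  assumes unit_Obj: "\<I> \<in> Obj V"
    and tensor_Obj: "\<lbrakk>u \<in> Obj V; v \<in> Obj V\<rbrakk> \<Longrightarrow> u \<otimes> v \<in> Obj V"
    and tensor_hom: "\<lbrakk>f \<in> hom u v; g \<in> hom w x\<rbrakk> \<Longrightarrow> f \<boxtimes> g \<in> hom (u \<otimes> w) (v \<otimes> x)"
    and tensor_ident: "\<lbrakk>u \<in> Obj V; v \<in> Obj V\<rbrakk> \<Longrightarrow> \<one> u \<boxtimes> \<one> v = \<one> (u \<otimes> v)"
    and tensor_seq: "\<lbrakk>f \<in> hom u v; g \<in> hom v w; f' \<in> hom u' v'; g' \<in> hom v' w'\<rbrakk>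
          \<Longrightarrow> (f \<Zsemi> g) \<boxtimes> (f' \<Zsemi> g') = (f \<boxtimes> f') \<Zsemi> (g \<boxtimes> g')"
    and assoc_hom: "\<lbrakk>u \<in> Obj V; v \<in> Obj V; w \<in> Obj V\<rbrakk>
          \<Longrightarrow> \<alpha> u v w \<in> hom ((u \<otimes> v) \<otimes> w) (u \<otimes> (v \<otimes> w))"
    and assoc_iso: "\<lbrakk>u \<in> Obj V; v \<in> Obj V; w \<in> Obj V\<rbrakk> \<Longrightarrow> iso (\<alpha> u v w)"
    and assoc_natural: "\<lbrakk>f \<in> hom u u'; g \<in> hom v v'; h \<in> hom w w'\<rbrakk>
          \<Longrightarrow> ((f \<boxtimes> g) \<boxtimes> h) \<Zsemi> \<alpha> u' v' w' = \<alpha> u v w \<Zsemi> (f \<boxtimes> (g \<boxtimes> h))"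
    and lunit_hom: "u \<in> Obj V \<Longrightarrow> \<l> u \<in> hom (\<I> \<otimes> u) u"
    and lunit_iso: "u \<in> Obj V \<Longrightarrow> iso (\<l> u)"
    and lunit_natural: "f \<in> hom u v \<Longrightarrow> (\<one> \<I> \<boxtimes> f) \<Zsemi> \<l> v = \<l> u \<Zsemi> f"
    and runit_hom: "u \<in> Obj V \<Longrightarrow> \<r> u \<in> hom (u \<otimes> \<I>) u"
    and runit_iso: "u \<in> Obj V \<Longrightarrow> iso (\<r> u)"
    and runit_natural: "f \<in> hom u v \<Longrightarrow> (f \<boxtimes> \<one> \<I>) \<Zsemi> \<r> v = \<r> u \<Zsemi> f"
    and pentagon: "\<lbrakk>u \<in> Obj V; v \<in> Obj V; w \<in> Obj V; x \<in> Obj V\<rbrakk>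
          \<Longrightarrow> (\<alpha> u v w \<boxtimes> \<one> x) \<Zsemi> \<alpha> u (v \<otimes> w) x \<Zsemi> (\<one> u \<boxtimes> \<alpha> v w x)
            = \<alpha> (u \<otimes> v) w x \<Zsemi> \<alpha> u v (w \<otimes> x)"
    and triangle: "\<lbrakk>u \<in> Obj V; v \<in> Obj V\<rbrakk>
          \<Longrightarrow> \<alpha> u \<I> v \<Zsemi> (\<one> u \<boxtimes> \<l> v) = \<r> u \<boxtimes> \<one> v"

locale braided_monoidal_category = monoidal_category +
  assumes braid_hom: "\<lbrakk>u \<in> Obj V; v \<in> Obj V\<rbrakk> \<Longrightarrow> \<beta> u v \<in> hom (u \<otimes> v) (v \<otimes> u)"
    and braid_iso: "\<lbrakk>u \<in> Obj V; v \<in> Obj V\<rbrakk> \<Longrightarrow> iso (\<beta> u v)"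
    and braid_natural: "\<lbrakk>f \<in> hom u u'; g \<in> hom v v'\<rbrakk>
          \<Longrightarrow> (f \<boxtimes> g) \<Zsemi> \<beta> u' v' = \<beta> u v \<Zsemi> (g \<boxtimes> f)"
    and hexagon1: "\<lbrakk>u \<in> Obj V; v \<in> Obj V; w \<in> Obj V\<rbrakk>
          \<Longrightarrow> \<alpha> u v w \<Zsemi> \<beta> u (v \<otimes> w) \<Zsemi> \<alpha> v w u
            = (\<beta> u v \<boxtimes> \<one> w) \<Zsemi> \<alpha> v u w \<Zsemi> (\<one> v \<boxtimes> \<beta> u w)"
    and hexagon2: "\<lbrakk>u \<in> Obj V; v \<in> Obj V; w \<in> Obj V\<rbrakk>
          \<Longrightarrow> inv (\<alpha> u v w) \<Zsemi> \<beta> (u \<otimes> v) w \<Zsemi> inv (\<alpha> w u v)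
            = (\<one> u \<boxtimes> \<beta> v w) \<Zsemi> inv (\<alpha> u w v) \<Zsemi> (\<beta> u w \<boxtimes> \<one> v)"

text \<open>
  The morphism \<open>1\<^sub>u \<beta>\<^sub>v\<^sub>,\<^sub>w 1\<^sub>x\<close>, with its associators, from
  \<open>(u \<otimes> v) \<otimes> (w \<otimes> x)\<close> to \<open>(u \<otimes> w) \<otimes> (v \<otimes> x)\<close>.
\<close>

definition mid_braid ::
    "('o, 'm, 'z) braided_data_scheme \<Rightarrow> 'o \<Rightarrow> 'o \<Rightarrow> 'o \<Rightarrow> 'o \<Rightarrow> 'm" where
  "mid_braid V u v w x =
     \<alpha>\<^bsub>V\<^esub> u v (w \<otimes>\<^bsub>V\<^esub> x)
     \<Zsemi>\<^bsub>V\<^esub> (\<one>\<^bsub>V\<^esub> u \<boxtimes>\<^bsub>V\<^esub> inv\<^bsub>V\<^esub> (\<alpha>\<^bsub>V\<^esub> v w x))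
     \<Zsemi>\<^bsub>V\<^esub> (\<one>\<^bsub>V\<^esub> u \<boxtimes>\<^bsub>V\<^esub> (\<beta>\<^bsub>V\<^esub> v w \<boxtimes>\<^bsub>V\<^esub> \<one>\<^bsub>V\<^esub> x))
     \<Zsemi>\<^bsub>V\<^esub> (\<one>\<^bsub>V\<^esub> u \<boxtimes>\<^bsub>V\<^esub> \<alpha>\<^bsub>V\<^esub> w v x)
     \<Zsemi>\<^bsub>V\<^esub> inv\<^bsub>V\<^esub> (\<alpha>\<^bsub>V\<^esub> u w (v \<otimes>\<^bsub>V\<^esub> x))"


section \<open>Enriched categories\<close>

text \<open>
  \<open>ecomp C a b c : C(a \<rightarrow> b) \<otimes> C(b \<rightarrow> c) \<rightarrow> C(a \<rightarrow> c)\<close>.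
\<close>

record ('c, 'o, 'm) enriched_data =
  eobj :: "'c set"
  ehom :: "'c \<Rightarrow> 'c \<Rightarrow> 'o"
  eid :: "'c \<Rightarrow> 'm"
  ecomp :: "'c \<Rightarrow> 'c \<Rightarrow> 'c \<Rightarrow> 'm"

locale enriched_category = braided_monoidal_category V
  for V :: "('o, 'm, 'z) braided_data_scheme" (structure) +
  fixes C :: "('c, 'o, 'm, 'y) enriched_data_scheme"
  assumes ehom_Obj: "\<lbrakk>a \<in> eobj C; b \<in> eobj C\<rbrakk> \<Longrightarrow> ehom C a b \<in> Obj V"
    and eid_hom: "a \<in> eobj C \<Longrightarrow> eid C a \<in> hom \<I> (ehom C a a)"
    and ecomp_hom: "\<lbrakk>a \<in> eobj C; b \<in> eobj C; c \<in> eobj C\<rbrakk>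
          \<Longrightarrow> ecomp C a b c \<in> hom (ehom C a b \<otimes> ehom C b c) (ehom C a c)"
    and eid_ecomp: "\<lbrakk>a \<in> eobj C; b \<in> eobj C\<rbrakk>
          \<Longrightarrow> (eid C a \<boxtimes> \<one> (ehom C a b)) \<Zsemi> ecomp C a a b = \<l> (ehom C a b)"
    and ecomp_eid: "\<lbrakk>a \<in> eobj C; b \<in> eobj C\<rbrakk>
          \<Longrightarrow> (\<one> (ehom C a b) \<boxtimes> eid C b) \<Zsemi> ecomp C a b b = \<r> (ehom C a b)"
    and ecomp_assoc: "\<lbrakk>a \<in> eobj C; b \<in> eobj C; c \<in> eobj C; d \<in> eobj C\<rbrakk>
          \<Longrightarrow> (ecomp C a b c \<boxtimes> \<one> (ehom C c d)) \<Zsemi> ecomp C a c d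
            = \<alpha> (ehom C a b) (ehom C b c) (ehom C c d)
              \<Zsemi> (\<one> (ehom C a b) \<boxtimes> ecomp C b c d) \<Zsemi> ecomp C a b d"

text \<open>
  \<open>mtensor C a b c d : C(a \<rightarrow> c) \<otimes> C(b \<rightarrow> d) \<rightarrow> C(ab \<rightarrow> cd)\<close>.
\<close>

record ('c, 'o, 'm) enriched_monoidal_data = "('c, 'o, 'm) enriched_data" +
  munit :: 'c
  mobj :: "'c \<Rightarrow> 'c \<Rightarrow> 'c"
  mtensor :: "'c \<Rightarrow> 'c \<Rightarrow> 'c \<Rightarrow> 'c \<Rightarrow> 'm"

locale enriched_monoidal_category = enriched_category V C
  for V :: "('o, 'm, 'z) braided_data_scheme" (structure)
    and C :: "('c, 'o, 'm, 'y) enriched_monoidal_data_scheme" +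
  assumes munit_eobj: "munit C \<in> eobj C"
    and mobj_eobj: "\<lbrakk>a \<in> eobj C; b \<in> eobj C\<rbrakk> \<Longrightarrow> mobj C a b \<in> eobj C"
    and munit_mobj: "a \<in> eobj C \<Longrightarrow> mobj C (munit C) a = a"
    and mobj_munit: "a \<in> eobj C \<Longrightarrow> mobj C a (munit C) = a"
    and mobj_assoc: "\<lbrakk>a \<in> eobj C; b \<in> eobj C; c \<in> eobj C\<rbrakk>
          \<Longrightarrow> mobj C (mobj C a b) c = mobj C a (mobj C b c)"
    and mtensor_hom: "\<lbrakk>a \<in> eobj C; b \<in> eobj C; c \<in> eobj C; d \<in> eobj C\<rbrakk>
          \<Longrightarrow> mtensor C a b c d
              \<in> hom (ehom C a c \<otimes> ehom C b d) (ehom C (mobj C a b) (mobj C c d))"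
    and munit_mtensor: "\<lbrakk>a \<in> eobj C; b \<in> eobj C\<rbrakk>
          \<Longrightarrow> (eid C (munit C) \<boxtimes> \<one> (ehom C a b)) \<Zsemi> mtensor C (munit C) a (munit C) b
            = \<l> (ehom C a b)"
    and mtensor_munit: "\<lbrakk>a \<in> eobj C; b \<in> eobj C\<rbrakk>
          \<Longrightarrow> (\<one> (ehom C a b) \<boxtimes> eid C (munit C)) \<Zsemi> mtensor C a (munit C) b (munit C)
            = \<r> (ehom C a b)"
    and mtensor_assoc:
      "\<lbrakk>a \<in> eobj C; b \<in> eobj C; c \<in> eobj C; a' \<in> eobj C; b' \<in> eobj C; c' \<in> eobj C\<rbrakk>
          \<Longrightarrow> (mtensor C a b a' b' \<boxtimes> \<one> (ehom C c c'))
              \<Zsemi> mtensor C (mobj C a b) c (mobj C a' b') c'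
            = \<alpha> (ehom C a a') (ehom C b b') (ehom C c c')
              \<Zsemi> (\<one> (ehom C a a') \<boxtimes> mtensor C b c b' c')
              \<Zsemi> mtensor C a (mobj C b c) a' (mobj C b' c')"
    \<comment> \<open>The identities are morphisms out of the unit object, whence the unitor
        \<open>\<I> \<otimes> \<I> \<rightarrow> \<I>\<close> on the right.\<close>
    and eid_mtensor: "\<lbrakk>a \<in> eobj C; b \<in> eobj C\<rbrakk>
          \<Longrightarrow> (eid C a \<boxtimes> eid C b) \<Zsemi> mtensor C a b a b = \<l> \<I> \<Zsemi> eid C (mobj C a b)"
    and interchange:
      "\<lbrakk>a \<in> eobj C; b \<in> eobj C; c \<in> eobj C; d \<in> eobj C; e \<in> eobj C; f \<in> eobj C\<rbrakk>
          \<Longrightarrow> (mtensor C a d b e \<boxtimes> mtensor C b e c f)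
              \<Zsemi> ecomp C (mobj C a d) (mobj C b e) (mobj C c f)
            = mid_braid V (ehom C a b) (ehom C d e) (ehom C b c) (ehom C e f)
              \<Zsemi> (ecomp C a b c \<boxtimes> ecomp C d e f)
              \<Zsemi> mtensor C a d c f"


section \<open>Enriched functors\<close>

record ('c, 'd, 'm) enriched_functor_data =
  fobj :: "'c \<Rightarrow> 'd"
  farr :: "'c \<Rightarrow> 'c \<Rightarrow> 'm"

locale enriched_functor = C: enriched_category V C + D: enriched_category V D
  for V :: "('o, 'm, 'z) braided_data_scheme" (structure)
    and C :: "('c, 'o, 'm, 'y) enriched_data_scheme"
    and D :: "('d, 'o, 'm, 'x) enriched_data_scheme" +
  fixes F :: "('c, 'd, 'm) enriched_functor_data"
  assumes fobj_eobj: "a \<in> eobj C \<Longrightarrow> fobj F a \<in> eobj D"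
    and farr_hom: "\<lbrakk>a \<in> eobj C; b \<in> eobj C\<rbrakk>
          \<Longrightarrow> farr F a b \<in> hom (ehom C a b) (ehom D (fobj F a) (fobj F b))"
    and farr_ecomp: "\<lbrakk>a \<in> eobj C; b \<in> eobj C; c \<in> eobj C\<rbrakk>
          \<Longrightarrow> ecomp C a b c \<Zsemi> farr F a c
            = (farr F a b \<boxtimes> farr F b c) \<Zsemi> ecomp D (fobj F a) (fobj F b) (fobj F c)"
    and farr_eid: "a \<in> eobj C \<Longrightarrow> eid C a \<Zsemi> farr F a a = eid D (fobj F a)"

text \<open>First \<open>F\<close>, then \<open>I\<close>.\<close>

definition functor_comp ::
    "('o, 'm, 'z) braided_data_scheme \<Rightarrow> ('c, 'd, 'm) enriched_functor_data
      \<Rightarrow> ('d, 'e, 'm) enriched_functor_data \<Rightarrow> ('c, 'e, 'm) enriched_functor_data" where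
  "functor_comp V F I =
     \<lparr>fobj = (\<lambda>a. fobj I (fobj F a)),
      farr = (\<lambda>a b. farr F a b \<Zsemi>\<^bsub>V\<^esub> farr I (fobj F a) (fobj F b))\<rparr>"


section \<open>Graded natural transformations\<close>

locale graded_transformation = F: enriched_functor V C D F + G: enriched_functor V C D G
  for V :: "('o, 'm, 'z) braided_data_scheme" (structure)
    and C :: "('c, 'o, 'm, 'y) enriched_data_scheme"
    and D :: "('d, 'o, 'm, 'x) enriched_data_scheme"
    and v :: 'o
    and F :: "('c, 'd, 'm) enriched_functor_data"
    and G :: "('c, 'd, 'm) enriched_functor_data" +
  fixes \<tau> :: "'c \<Rightarrow> 'm"
  assumes grade_Obj: "v \<in> Obj V"
    and component_hom: "a \<in> eobj C \<Longrightarrow> \<tau> a \<in> hom v (ehom D (fobj F a) (fobj G a))"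
    and graded_natural: "\<lbrakk>a \<in> eobj C; b \<in> eobj C\<rbrakk>
          \<Longrightarrow> (\<tau> a \<boxtimes> farr G a b) \<Zsemi> ecomp D (fobj F a) (fobj G a) (fobj G b)
            = \<beta> v (ehom C a b) \<Zsemi> (farr F a b \<boxtimes> \<tau> b)
              \<Zsemi> ecomp D (fobj F a) (fobj F b) (fobj G b)"

text \<open>Vertical composite of \<open>\<sigma> : F \<Rightarrow> G\<close> and \<open>\<tau> : G \<Rightarrow> H\<close>, for functors with target \<open>D\<close>.\<close>

definition vertical ::
    "('o, 'm, 'z) braided_data_scheme \<Rightarrow> ('d, 'o, 'm, 'x) enriched_data_scheme
      \<Rightarrow> ('c, 'd, 'm) enriched_functor_data \<Rightarrow> ('c, 'd, 'm) enriched_functor_data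
      \<Rightarrow> ('c, 'd, 'm) enriched_functor_data \<Rightarrow> ('c \<Rightarrow> 'm) \<Rightarrow> ('c \<Rightarrow> 'm) \<Rightarrow> 'c \<Rightarrow> 'm" where
  "vertical V D F G H \<sigma> \<tau> =
     (\<lambda>a. (\<sigma> a \<boxtimes>\<^bsub>V\<^esub> \<tau> a) \<Zsemi>\<^bsub>V\<^esub> ecomp D (fobj F a) (fobj G a) (fobj H a))"

text \<open>
  Horizontal composite of \<open>\<sigma> : F \<Rightarrow> G\<close> and \<open>\<tau> : I \<Rightarrow> J\<close>, where \<open>E\<close> is the target of \<open>I\<close> and \<open>J\<close>.
\<close>

definition horizontal ::
    "('o, 'm, 'z) braided_data_scheme \<Rightarrow> ('e, 'o, 'm, 'x) enriched_data_scheme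
      \<Rightarrow> ('c, 'd, 'm) enriched_functor_data \<Rightarrow> ('c, 'd, 'm) enriched_functor_data
      \<Rightarrow> ('d, 'e, 'm) enriched_functor_data \<Rightarrow> ('d, 'e, 'm) enriched_functor_data
      \<Rightarrow> ('c \<Rightarrow> 'm) \<Rightarrow> ('d \<Rightarrow> 'm) \<Rightarrow> 'c \<Rightarrow> 'm" where
  "horizontal V E F G I J \<sigma> \<tau> =
     (\<lambda>a. (\<sigma> a \<boxtimes>\<^bsub>V\<^esub> \<tau> (fobj G a))
          \<Zsemi>\<^bsub>V\<^esub> (farr I (fobj F a) (fobj G a)
               \<boxtimes>\<^bsub>V\<^esub> \<one>\<^bsub>V\<^esub> (ehom E (fobj I (fobj G a)) (fobj J (fobj G a))))
          \<Zsemi>\<^bsub>V\<^esub> ecomp E (fobj I (fobj F a)) (fobj I (fobj G a)) (fobj J (fobj G a)))"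

end

theory Submission
  imports Defs
begin

text \<open>
  Fix \<open>a\<close>. Both sides of the identity are built from four generalized morphisms, that is, morphisms
  of \<open>V\<close> into hom objects of \<open>E\<close>: the image of \<open>\<kappa>\<^sub>a\<close> under \<open>I\<close>, a component of \<open>lam\<close>, the image of \<open>\<mu>\<^sub>a\<close> under \<open>J\<close> or under \<open>I\<close>,
  and \<open>\<nu>\<^sub>H\<^sub>a\<close>. On the left these are multiplied in the order
  \<open>(I\<kappa>\<^sub>a \<cdot> lam\<^sub>G\<^sub>a) \<cdot> (J\<mu>\<^sub>a \<cdot> \<nu>\<^sub>H\<^sub>a)\<close>; on the right, because \<open>I\<close> preserves composition, in the order
  \<open>(I\<kappa>\<^sub>a \<cdot> I\<mu>\<^sub>a) \<cdot> (lam\<^sub>H\<^sub>a \<cdot> \<nu>\<^sub>H\<^sub>a)\<close>.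

  Both fourfold products can be rebracketed so that the two middle factors are composed first
  (\<open>compose_middle_first\<close>). The middle factors are then \<open>lam\<^sub>G\<^sub>a \<cdot> J\<mu>\<^sub>a\<close> and \<open>I\<mu>\<^sub>a \<cdot> lam\<^sub>H\<^sub>a\<close>, which
  graded naturality of \<open>lam\<close>, applied to the generalized morphism \<open>\<mu>\<^sub>a\<close>, identifies up to
  \<open>\<beta>\<^sub>v\<^sub>,\<^sub>w\<close> (\<open>slide_past_component\<close>). The rebracketing turns this braiding into exactly
  \<open>1\<^sub>u \<beta>\<^sub>v\<^sub>,\<^sub>w 1\<^sub>x\<close> (\<open>mid_braid_rebracket\<close>). No coherence theorem enters: the associators left over on
  the two sides coincide, or cancel against their inverses.
\<close>

section \<open>Inverse associators and the middle braiding\<close>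

lemma (in category) inv_inverse_arrows:
  assumes "iso f"
  shows "inverse_arrows V f (inv f)"
proof -
  have unique: "g = h" if g: "inverse_arrows V f g" and h: "inverse_arrows V f h" for g h
  proof -
    have f: "f \<in> hom (Dom V f) (Cod V f)"
      using g by (simp add: inverse_arrows_def hom_def)
    have gh: "g \<in> hom (Cod V f) (Dom V f)" "h \<in> hom (Cod V f) (Dom V f)"
      using g h by (simp_all add: inverse_arrows_def)
    have "g = g \<Zsemi> (f \<Zsemi> h)"
      using h seq_ident[OF gh(1)] by (simp add: inverse_arrows_def)
    also have "\<dots> = (g \<Zsemi> f) \<Zsemi> h"
      using seq_assoc[OF gh(1) f gh(2)] by simp
    also have "\<dots> = h"
      using g ident_seq[OF gh(2)] by (simp add: inverse_arrows_def)
    finally show ?thesis .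
  qed
  from assms obtain g where "inverse_arrows V f g"
    by (auto simp: iso_def)
  then show ?thesis
    unfolding inverse_arr_def by (rule theI) (rule unique[OF _ \<open>inverse_arrows V f g\<close>])
qed

context monoidal_category
begin

lemma
  assumes "u \<in> Obj V" "v \<in> Obj V" "w \<in> Obj V"
  shows inv_assoc_hom: "inv (\<alpha> u v w) \<in> hom (u \<otimes> (v \<otimes> w)) ((u \<otimes> v) \<otimes> w)"
    and inv_assoc_assoc: "inv (\<alpha> u v w) \<Zsemi> \<alpha> u v w = \<one> (u \<otimes> (v \<otimes> w))"
    and assoc_inv_assoc: "\<alpha> u v w \<Zsemi> inv (\<alpha> u v w) = \<one> ((u \<otimes> v) \<otimes> w)"
  using inv_inverse_arrows[OF assoc_iso[OF assms]] assoc_hom[OF assms]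
  by (simp_all add: inverse_arrows_def hom_def)

lemma tensor_seq_left:
  assumes "p \<in> Obj V" "g \<in> hom q r" "f \<in> hom p s" "h \<in> hom r t"
  shows "f \<boxtimes> (g \<Zsemi> h) = (\<one> p \<boxtimes> g) \<Zsemi> (f \<boxtimes> h)"
  using tensor_seq[OF ident_hom[OF assms(1)] assms(3,2,4)] ident_seq[OF assms(3)] by simp

lemma hom_Obj:
  assumes "f \<in> hom u v"
  shows "u \<in> Obj V" "v \<in> Obj V"
  using assms Dom_Obj Cod_Obj by (auto simp: hom_def)

end

lemma (in braided_monoidal_category) mid_braid_hom:
  assumes "u \<in> Obj V" "v \<in> Obj V" "w \<in> Obj V" "x \<in> Obj V"
  shows "mid_braid V u v w x \<in> hom ((u \<otimes> v) \<otimes> (w \<otimes> x)) ((u \<otimes> w) \<otimes> (v \<otimes> x))"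
  unfolding mid_braid_def
  by (rule seq_hom assoc_hom inv_assoc_hom tensor_hom ident_hom braid_hom tensor_Obj assms)+

text \<open>
  The trailing associators of \<open>mid_braid\<close> are the inverses of those that bring
  \<open>(u \<otimes> w) \<otimes> (v \<otimes> x)\<close> to the bracketing \<open>u \<otimes> ((w \<otimes> v) \<otimes> x)\<close>, so in that bracketing only the
  bare braiding remains.
\<close>

lemma (in braided_monoidal_category) mid_braid_rebracket:
  assumes "u \<in> Obj V" "v \<in> Obj V" "w \<in> Obj V" "x \<in> Obj V"
  shows "mid_braid V u v w x \<Zsemi> (\<alpha> u w (v \<otimes> x) \<Zsemi> (\<one> u \<boxtimes> inv (\<alpha> w v x)))
    = (\<alpha> u v (w \<otimes> x) \<Zsemi> (\<one> u \<boxtimes> inv (\<alpha> v w x))) \<Zsemi> (\<one> u \<boxtimes> (\<beta> v w \<boxtimes> \<one> x))"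
proof -
  let ?p = "\<alpha> u v (w \<otimes> x) \<Zsemi> (\<one> u \<boxtimes> inv (\<alpha> v w x)) \<Zsemi> (\<one> u \<boxtimes> (\<beta> v w \<boxtimes> \<one> x))"
  let ?q = "\<one> u \<boxtimes> \<alpha> w v x" and ?q' = "\<one> u \<boxtimes> inv (\<alpha> w v x)"
  let ?r = "\<alpha> u w (v \<otimes> x)" and ?r' = "inv (\<alpha> u w (v \<otimes> x))"
  have p: "?p \<in> hom ((u \<otimes> v) \<otimes> (w \<otimes> x)) (u \<otimes> ((w \<otimes> v) \<otimes> x))"
    by (rule seq_hom assoc_hom inv_assoc_hom tensor_hom ident_hom braid_hom tensor_Obj assms)+
  have q: "?q \<in> hom (u \<otimes> ((w \<otimes> v) \<otimes> x)) (u \<otimes> (w \<otimes> (v \<otimes> x)))"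
    and q': "?q' \<in> hom (u \<otimes> (w \<otimes> (v \<otimes> x))) (u \<otimes> ((w \<otimes> v) \<otimes> x))"
    and r: "?r \<in> hom ((u \<otimes> w) \<otimes> (v \<otimes> x)) (u \<otimes> (w \<otimes> (v \<otimes> x)))"
    and r': "?r' \<in> hom (u \<otimes> (w \<otimes> (v \<otimes> x))) ((u \<otimes> w) \<otimes> (v \<otimes> x))"
    by (intro assoc_hom inv_assoc_hom tensor_hom ident_hom tensor_Obj assms)+
  have "?q \<Zsemi> ?q' = \<one> u \<boxtimes> (\<alpha> w v x \<Zsemi> inv (\<alpha> w v x))"
    by (rule tensor_seq_left[OF assms(1) assoc_hom ident_hom inv_assoc_hom, symmetric])
      (rule assms)+
  then have qq': "?q \<Zsemi> ?q' = \<one> (u \<otimes> ((w \<otimes> v) \<otimes> x))"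
    by (simp add: assoc_inv_assoc tensor_ident tensor_Obj assms)
  have rr: "?r' \<Zsemi> ?r = \<one> (u \<otimes> (w \<otimes> (v \<otimes> x)))"
    by (simp add: inv_assoc_assoc tensor_Obj assms)
  have "mid_braid V u v w x \<Zsemi> (?r \<Zsemi> ?q') = (?p \<Zsemi> ?q) \<Zsemi> (?r' \<Zsemi> (?r \<Zsemi> ?q'))"
    unfolding mid_braid_def by (rule seq_assoc[OF seq_hom[OF p q] r' seq_hom[OF r q']])
  also have "?r' \<Zsemi> (?r \<Zsemi> ?q') = ?q'"
    using seq_assoc[OF r' r q'] by (simp add: rr ident_seq[OF q'])
  also have "(?p \<Zsemi> ?q) \<Zsemi> ?q' = ?p"
    by (simp add: seq_assoc[OF p q q'] qq' seq_ident[OF p])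
  finally show ?thesis .
qed

section \<open>Products of generalized morphisms\<close>

context enriched_category
begin

text \<open>
  A morphism \<open>p \<rightarrow> C(a \<rightarrow> b)\<close> is treated as a generalized morphism from \<open>a\<close> to \<open>b\<close> of grade \<open>p\<close>,
  and \<open>elem_comp a b c f g\<close> is written \<open>f \<cdot> g\<close> in the comments. With this product the enriched
  axioms, which concern whole hom objects, read as algebraic laws at arbitrary grades.
\<close>

definition elem_comp :: "'c \<Rightarrow> 'c \<Rightarrow> 'c \<Rightarrow> 'm \<Rightarrow> 'm \<Rightarrow> 'm" where
  "elem_comp a b c f g = (f \<boxtimes> g) \<Zsemi> ecomp C a b c"

lemma elem_comp_hom:
  assumes "a \<in> eobj C" "b \<in> eobj C" "c \<in> eobj C"
    and "f \<in> hom p (ehom C a b)" "g \<in> hom q (ehom C b c)"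
  shows "elem_comp a b c f g \<in> hom (p \<otimes> q) (ehom C a c)"
  unfolding elem_comp_def by (rule seq_hom tensor_hom ecomp_hom assms)+

lemma elem_comp_precompose:
  assumes "a \<in> eobj C" "b \<in> eobj C" "c \<in> eobj C"
    and "s \<in> hom p' p" "t \<in> hom q' q"
    and "f \<in> hom p (ehom C a b)" "g \<in> hom q (ehom C b c)"
  shows "elem_comp a b c (s \<Zsemi> f) (t \<Zsemi> g) = (s \<boxtimes> t) \<Zsemi> elem_comp a b c f g"
  unfolding elem_comp_def tensor_seq[OF assms(4,6,5,7)]
  by (rule seq_assoc[OF tensor_hom[OF assms(4,5)] tensor_hom[OF assms(6,7)]
        ecomp_hom[OF assms(1,2,3)]])

lemma elem_comp_assoc:
  assumes obj: "a \<in> eobj C" "b \<in> eobj C" "c \<in> eobj C" "d \<in> eobj C"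
    and f: "f \<in> hom p (ehom C a b)" and g: "g \<in> hom q (ehom C b c)"
    and h: "h \<in> hom r (ehom C c d)"
  shows "elem_comp a c d (elem_comp a b c f g) h
    = \<alpha> p q r \<Zsemi> elem_comp a b d f (elem_comp b c d g h)"
proof -
  note grades = hom_Obj(1)[OF f] hom_Obj(1)[OF g] hom_Obj(1)[OF h]
  let ?P = "ehom C a b" and ?Q = "ehom C b c" and ?R = "ehom C c d"
  have homs: "?P \<in> Obj V" "?Q \<in> Obj V" "?R \<in> Obj V"
    using obj ehom_Obj by auto
  note fg = tensor_hom[OF f g] and gh = tensor_hom[OF g h]
  note comp1 = ecomp_hom[OF obj(1,2,3)] and comp2 = ecomp_hom[OF obj(2,3,4)]
    and comp1' = ecomp_hom[OF obj(1,3,4)] and comp2' = ecomp_hom[OF obj(1,2,4)]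
  note A = assoc_hom[OF homs]
  note left = tensor_hom[OF comp1 ident_hom[OF homs(3)]]
    and right = tensor_hom[OF ident_hom[OF homs(1)] comp2]
  have "elem_comp a c d (elem_comp a b c f g) h
      = (((f \<boxtimes> g) \<boxtimes> h) \<Zsemi> (ecomp C a b c \<boxtimes> \<one> ?R)) \<Zsemi> ecomp C a c d"
    using tensor_seq[OF fg comp1 h ident_hom[OF homs(3)]] seq_ident[OF h]
    by (simp add: elem_comp_def)
  also have "\<dots> = ((f \<boxtimes> g) \<boxtimes> h) \<Zsemi> ((ecomp C a b c \<boxtimes> \<one> ?R) \<Zsemi> ecomp C a c d)"
    by (rule seq_assoc[OF tensor_hom[OF fg h] left comp1'])
  also have "\<dots> = ((f \<boxtimes> g) \<boxtimes> h)
      \<Zsemi> (\<alpha> ?P ?Q ?R \<Zsemi> ((\<one> ?P \<boxtimes> ecomp C b c d) \<Zsemi> ecomp C a b d))"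
    by (simp add: ecomp_assoc[OF obj] seq_assoc[OF A right comp2'])
  also have "\<dots> = (((f \<boxtimes> g) \<boxtimes> h) \<Zsemi> \<alpha> ?P ?Q ?R)
      \<Zsemi> ((\<one> ?P \<boxtimes> ecomp C b c d) \<Zsemi> ecomp C a b d)"
    by (rule seq_assoc[OF tensor_hom[OF fg h] A seq_hom[OF right comp2'], symmetric])
  also have "\<dots> = (\<alpha> p q r \<Zsemi> (f \<boxtimes> (g \<boxtimes> h)))
      \<Zsemi> ((\<one> ?P \<boxtimes> ecomp C b c d) \<Zsemi> ecomp C a b d)"
    by (simp add: assoc_natural[OF f g h])
  also have "\<dots> = \<alpha> p q r \<Zsemi> ((f \<boxtimes> (g \<boxtimes> h)) \<Zsemi> ((\<one> ?P \<boxtimes> ecomp C b c d) \<Zsemi> ecomp C a b d))"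
    by (rule seq_assoc[OF assoc_hom[OF grades] tensor_hom[OF f gh] seq_hom[OF right comp2']])
  also have "(f \<boxtimes> (g \<boxtimes> h)) \<Zsemi> ((\<one> ?P \<boxtimes> ecomp C b c d) \<Zsemi> ecomp C a b d)
      = ((f \<boxtimes> (g \<boxtimes> h)) \<Zsemi> (\<one> ?P \<boxtimes> ecomp C b c d)) \<Zsemi> ecomp C a b d"
    by (rule seq_assoc[OF tensor_hom[OF f gh] right comp2', symmetric])
  also have "\<dots> = elem_comp a b d f (elem_comp b c d g h)"
    using tensor_seq[OF f ident_hom[OF homs(1)] gh comp2] seq_ident[OF f]
    by (simp add: elem_comp_def)
  finally show ?thesis .
qed

text \<open>
  Two uses of associativity, \<open>(f \<cdot> g) \<cdot> (h \<cdot> k) = f \<cdot> (g \<cdot> (h \<cdot> k)) = f \<cdot> ((g \<cdot> h) \<cdot> k)\<close>, expose the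
  product of the middle factors, the only place where the two sides of the interchange law differ.
\<close>

lemma compose_middle_first:
  assumes obj: "a \<in> eobj C" "b \<in> eobj C" "c \<in> eobj C" "d \<in> eobj C" "e \<in> eobj C"
    and f: "f \<in> hom p (ehom C a b)" and g: "g \<in> hom q (ehom C b c)"
    and h: "h \<in> hom r (ehom C c d)" and k: "k \<in> hom s (ehom C d e)"
  shows "elem_comp a c e (elem_comp a b c f g) (elem_comp c d e h k)
    = (\<alpha> p q (r \<otimes> s) \<Zsemi> (\<one> p \<boxtimes> inv (\<alpha> q r s)))
      \<Zsemi> elem_comp a b e f (elem_comp b d e (elem_comp b c d g h) k)"
proof -
  note grades = hom_Obj(1)[OF f] hom_Obj(1)[OF g] hom_Obj(1)[OF h] hom_Obj(1)[OF k]
  let ?ghk = "elem_comp b d e (elem_comp b c d g h) k"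
  let ?ghk' = "elem_comp b c e g (elem_comp c d e h k)"
  have hk: "elem_comp c d e h k \<in> hom (r \<otimes> s) (ehom C c e)"
    by (rule elem_comp_hom[OF obj(3,4,5) h k])
  have ghk: "?ghk \<in> hom ((q \<otimes> r) \<otimes> s) (ehom C b e)"
    by (rule elem_comp_hom[OF obj(2,4,5) elem_comp_hom[OF obj(2,3,4) g h] k])
  have ghk': "?ghk' \<in> hom (q \<otimes> (r \<otimes> s)) (ehom C b e)"
    by (rule elem_comp_hom[OF obj(2,3,5) g hk])
  note A = assoc_hom[OF grades(2,3,4)] and A' = inv_assoc_hom[OF grades(2,3,4)]
  have "inv (\<alpha> q r s) \<Zsemi> ?ghk = inv (\<alpha> q r s) \<Zsemi> (\<alpha> q r s \<Zsemi> ?ghk')"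
    by (simp add: elem_comp_assoc[OF obj(2,3,4,5) g h k])
  also have "\<dots> = ?ghk'"
    using seq_assoc[OF A' A ghk'] by (simp add: inv_assoc_assoc grades ident_seq[OF ghk'])
  finally have mid: "?ghk' = inv (\<alpha> q r s) \<Zsemi> ?ghk" ..
  have "elem_comp a c e (elem_comp a b c f g) (elem_comp c d e h k)
      = \<alpha> p q (r \<otimes> s) \<Zsemi> elem_comp a b e f ?ghk'"
    by (rule elem_comp_assoc[OF obj(1,2,3,5) f g hk])
  also have "elem_comp a b e f ?ghk' = (\<one> p \<boxtimes> inv (\<alpha> q r s)) \<Zsemi> elem_comp a b e f ?ghk"
    unfolding mid
    using elem_comp_precompose[OF obj(1,2,5) ident_hom[OF grades(1)] A' f ghk] ident_seq[OF f]
    by simp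
  also have "\<alpha> p q (r \<otimes> s) \<Zsemi> ((\<one> p \<boxtimes> inv (\<alpha> q r s)) \<Zsemi> elem_comp a b e f ?ghk)
      = (\<alpha> p q (r \<otimes> s) \<Zsemi> (\<one> p \<boxtimes> inv (\<alpha> q r s))) \<Zsemi> elem_comp a b e f ?ghk"
    by (rule seq_assoc[OF assoc_hom[OF grades(1,2) tensor_Obj[OF grades(3,4)]]
          tensor_hom[OF ident_hom[OF grades(1)] A'] elem_comp_hom[OF obj(1,2,5) f ghk], symmetric])
  finally show ?thesis .
qed

end

section \<open>Functors and graded transformations on generalized morphisms\<close>

lemma (in enriched_functor) functor_elem_comp:
  assumes obj: "a \<in> eobj C" "b \<in> eobj C" "c \<in> eobj C"
    and f: "f \<in> hom p (ehom C a b)" and g: "g \<in> hom q (ehom C b c)"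
  shows "C.elem_comp a b c f g \<Zsemi> farr F a c
    = D.elem_comp (fobj F a) (fobj F b) (fobj F c) (f \<Zsemi> farr F a b) (g \<Zsemi> farr F b c)"
proof -
  note Fab = farr_hom[OF obj(1,2)] and Fbc = farr_hom[OF obj(2,3)] and Fac = farr_hom[OF obj(1,3)]
  have comp: "ecomp D (fobj F a) (fobj F b) (fobj F c)
      \<in> hom (ehom D (fobj F a) (fobj F b) \<otimes> ehom D (fobj F b) (fobj F c))
            (ehom D (fobj F a) (fobj F c))"
    by (intro D.ecomp_hom fobj_eobj obj)
  show ?thesis
    unfolding C.elem_comp_def D.elem_comp_def
    by (simp add: C.seq_assoc[OF C.tensor_hom[OF f g] C.ecomp_hom[OF obj] Fac] farr_ecomp[OF obj]
        C.tensor_seq[OF f Fab g Fbc]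
        C.seq_assoc[OF C.tensor_hom[OF f g] C.tensor_hom[OF Fab Fbc] comp])
qed

text \<open>
  Graded naturality is stated for the whole hom object \<open>C(a \<rightarrow> b)\<close>; naturality of the braiding
  transports it along \<open>h\<close>, so that a component may be moved past a morphism of any grade.
\<close>

lemma (in graded_transformation) slide_past_component:
  assumes obj: "a \<in> eobj C" "b \<in> eobj C" and h: "h \<in> hom w (ehom C a b)"
  shows "F.D.elem_comp (fobj F a) (fobj G a) (fobj G b) (\<tau> a) (h \<Zsemi> farr G a b)
    = \<beta> v w \<Zsemi> F.D.elem_comp (fobj F a) (fobj F b) (fobj G b) (h \<Zsemi> farr F a b) (\<tau> b)"
proof -
  let ?X = "ehom C a b"
  note t = component_hom[OF obj(1)] and t' = component_hom[OF obj(2)]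
  note Farr = F.farr_hom[OF obj] and Garr = G.farr_hom[OF obj]
  note w = F.C.hom_Obj(1)[OF h] and X = F.C.hom_Obj(2)[OF h]
  note Fobj = F.fobj_eobj[OF obj(1)] F.fobj_eobj[OF obj(2)]
    and Gobj = G.fobj_eobj[OF obj(1)] G.fobj_eobj[OF obj(2)]
  note idv = F.C.ident_hom[OF grade_Obj]
  note comp = F.D.ecomp_hom[OF Fobj(1,2) Gobj(2)]
  note braid = F.C.braid_hom[OF grade_Obj X]
  note low = F.D.elem_comp_hom[OF Fobj(1,2) Gobj(2) Farr t']
  have "F.D.elem_comp (fobj F a) (fobj G a) (fobj G b) (\<tau> a) (h \<Zsemi> farr G a b)
      = (\<one> v \<boxtimes> h) \<Zsemi> F.D.elem_comp (fobj F a) (fobj G a) (fobj G b) (\<tau> a) (farr G a b)"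
    using F.D.elem_comp_precompose[OF Fobj(1) Gobj idv h t Garr] F.C.ident_seq[OF t] by simp
  also have "F.D.elem_comp (fobj F a) (fobj G a) (fobj G b) (\<tau> a) (farr G a b)
      = \<beta> v ?X \<Zsemi> F.D.elem_comp (fobj F a) (fobj F b) (fobj G b) (farr F a b) (\<tau> b)"
    unfolding F.D.elem_comp_def graded_natural[OF obj]
    by (rule F.C.seq_assoc[OF braid F.C.tensor_hom[OF Farr t'] comp])
  also have "(\<one> v \<boxtimes> h) \<Zsemi> (\<beta> v ?X
        \<Zsemi> F.D.elem_comp (fobj F a) (fobj F b) (fobj G b) (farr F a b) (\<tau> b))
      = ((\<one> v \<boxtimes> h) \<Zsemi> \<beta> v ?X)
        \<Zsemi> F.D.elem_comp (fobj F a) (fobj F b) (fobj G b) (farr F a b) (\<tau> b)"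
    by (rule F.C.seq_assoc[OF F.C.tensor_hom[OF idv h] braid low, symmetric])
  also have "\<dots> = (\<beta> v w \<Zsemi> (h \<boxtimes> \<one> v))
        \<Zsemi> F.D.elem_comp (fobj F a) (fobj F b) (fobj G b) (farr F a b) (\<tau> b)"
    by (simp add: F.C.braid_natural[OF idv h])
  also have "\<dots> = \<beta> v w \<Zsemi> ((h \<boxtimes> \<one> v)
        \<Zsemi> F.D.elem_comp (fobj F a) (fobj F b) (fobj G b) (farr F a b) (\<tau> b))"
    by (rule F.C.seq_assoc[OF F.C.braid_hom[OF grade_Obj w] F.C.tensor_hom[OF h idv] low])
  also have "(h \<boxtimes> \<one> v) \<Zsemi> F.D.elem_comp (fobj F a) (fobj F b) (fobj G b) (farr F a b) (\<tau> b)
      = F.D.elem_comp (fobj F a) (fobj F b) (fobj G b) (h \<Zsemi> farr F a b) (\<tau> b)"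
    using F.D.elem_comp_precompose[OF Fobj Gobj(2) h idv Farr t'] F.C.ident_seq[OF t'] by simp
  finally show ?thesis .
qed

text \<open>
  The left side is the shape in which horizontal composites are defined. Absorbing the functor into
  the first factor makes such a composite a product of generalized morphisms, to which the
  rebracketing applies.
\<close>

lemma (in enriched_functor) whisker_elem_comp:
  assumes obj: "a \<in> eobj C" "b \<in> eobj C" "c \<in> eobj D"
    and f: "f \<in> hom p (ehom C a b)" and g: "g \<in> hom q (ehom D (fobj F b) c)"
  shows "(f \<boxtimes> g) \<Zsemi> (farr F a b \<boxtimes> \<one> (ehom D (fobj F b) c)) \<Zsemi> ecomp D (fobj F a) (fobj F b) c
    = D.elem_comp (fobj F a) (fobj F b) c (f \<Zsemi> farr F a b) g"
  unfolding D.elem_comp_def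
  using C.tensor_seq[OF f farr_hom[OF obj(1,2)] g C.ident_hom[OF C.hom_Obj(2)[OF g]]]
    C.seq_ident[OF g]
  by simp

section \<open>The interchange law\<close>

theorem lemma2p4:
  fixes V :: "('o, 'm) braided_data"
    and C :: "('c, 'o, 'm) enriched_monoidal_data"
    and D :: "('d, 'o, 'm) enriched_monoidal_data"
    and E :: "('e, 'o, 'm) enriched_monoidal_data"
    and F G H :: "('c, 'd, 'm) enriched_functor_data"
    and I J K :: "('d, 'e, 'm) enriched_functor_data"
    and \<kappa> \<mu> :: "'c \<Rightarrow> 'm"
    and lam \<nu> :: "'d \<Rightarrow> 'm"
    and u v w x :: 'o
    and a :: 'c
  assumes "braided_monoidal_category V"
    and "enriched_monoidal_category V C"
    and "enriched_monoidal_category V D"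
    and "enriched_monoidal_category V E"
    and "enriched_functor V C D F" "enriched_functor V C D G" "enriched_functor V C D H"
    and "enriched_functor V D E I" "enriched_functor V D E J" "enriched_functor V D E K"
    and "u \<in> Obj V" "v \<in> Obj V" "w \<in> Obj V" "x \<in> Obj V"
    and "graded_transformation V C D u F G \<kappa>"
    and "graded_transformation V D E v I J lam"
    and "graded_transformation V C D w G H \<mu>"
    and "graded_transformation V D E x J K \<nu>"
    and "a \<in> eobj C"
  shows
    "vertical V E (functor_comp V F I) (functor_comp V G J) (functor_comp V H K)
        (horizontal V E F G I J \<kappa> lam) (horizontal V E G H J K \<mu> \<nu>) a
      \<in> hom\<^bsub>V\<^esub> ((u \<otimes>\<^bsub>V\<^esub> v) \<otimes>\<^bsub>V\<^esub> (w \<otimes>\<^bsub>V\<^esub> x)) (ehom E (fobj I (fobj F a)) (fobj K (fobj H a)))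
     \<and> vertical V E (functor_comp V F I) (functor_comp V G J) (functor_comp V H K)
        (horizontal V E F G I J \<kappa> lam) (horizontal V E G H J K \<mu> \<nu>) a
      = mid_braid V u v w x
        \<Zsemi>\<^bsub>V\<^esub> horizontal V E F H I K
             (vertical V D F G H \<kappa> \<mu>) (vertical V E I J K lam \<nu>) a"
proof -
  interpret V: braided_monoidal_category V by fact
  interpret D: enriched_monoidal_category V D by fact
  interpret E: enriched_monoidal_category V E by fact
  interpret F: enriched_functor V C D F by fact
  interpret G: enriched_functor V C D G by fact
  interpret H: enriched_functor V C D H by fact
  interpret I: enriched_functor V D E I by fact
  interpret J: enriched_functor V D E J by fact
  interpret K: enriched_functor V D E K by fact
  interpret kappa: graded_transformation V C D u F G \<kappa> by fact
  interpret lam: graded_transformation V D E v I J lam by fact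
  interpret mu: graded_transformation V C D w G H \<mu> by fact
  interpret nu: graded_transformation V D E x J K \<nu> by fact
  note a = \<open>a \<in> eobj C\<close> and grades = \<open>u \<in> Obj V\<close> \<open>v \<in> Obj V\<close> \<open>w \<in> Obj V\<close> \<open>x \<in> Obj V\<close>
  let ?f = "fobj F a" and ?g = "fobj G a" and ?h = "fobj H a"
  let ?If = "fobj I ?f" and ?Ig = "fobj I ?g" and ?Ih = "fobj I ?h"
    and ?Jg = "fobj J ?g" and ?Jh = "fobj J ?h" and ?Kh = "fobj K ?h"
  note fgh = F.fobj_eobj[OF a] G.fobj_eobj[OF a] H.fobj_eobj[OF a]
  note Iobj = fgh[THEN I.fobj_eobj] and Jobj = fgh[THEN J.fobj_eobj]
    and Kobj = fgh[THEN K.fobj_eobj]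
  note k = kappa.component_hom[OF a] and m = mu.component_hom[OF a]
  note lg = lam.component_hom[OF fgh(2)] and lh = lam.component_hom[OF fgh(3)]
    and n = nu.component_hom[OF fgh(3)]
  let ?Ik = "\<kappa> a \<Zsemi>\<^bsub>V\<^esub> farr I ?f ?g" and ?Im = "\<mu> a \<Zsemi>\<^bsub>V\<^esub> farr I ?g ?h"
    and ?Jm = "\<mu> a \<Zsemi>\<^bsub>V\<^esub> farr J ?g ?h"
  note Ik = V.seq_hom[OF k I.farr_hom[OF fgh(1,2)]]
    and Im = V.seq_hom[OF m I.farr_hom[OF fgh(2,3)]]
    and Jm = V.seq_hom[OF m J.farr_hom[OF fgh(2,3)]]
  let ?L = "vertical V E (functor_comp V F I) (functor_comp V G J) (functor_comp V H K)
        (horizontal V E F G I J \<kappa> lam) (horizontal V E G H J K \<mu> \<nu>) a"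
  let ?R = "horizontal V E F H I K (vertical V D F G H \<kappa> \<mu>) (vertical V E I J K lam \<nu>) a"
  let ?rebracket = "\<lambda>v w. \<alpha>\<^bsub>V\<^esub> u v (w \<otimes>\<^bsub>V\<^esub> x) \<Zsemi>\<^bsub>V\<^esub> (\<one>\<^bsub>V\<^esub> u \<boxtimes>\<^bsub>V\<^esub> inv\<^bsub>V\<^esub> (\<alpha>\<^bsub>V\<^esub> v w x))"
  let ?mid = "E.elem_comp ?Ig ?Ih ?Jh ?Im (lam ?h)"
  let ?midn = "E.elem_comp ?Ig ?Jh ?Kh ?mid (\<nu> ?h)"
  let ?all = "E.elem_comp ?If ?Ig ?Kh ?Ik ?midn"
  let ?braid = "\<beta>\<^bsub>V\<^esub> v w \<boxtimes>\<^bsub>V\<^esub> \<one>\<^bsub>V\<^esub> x"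
  \<comment> \<open>In \<open>?L\<close> the transformation \<open>lam\<close> acts at \<open>G a\<close> and so meets \<open>J\<mu>\<^sub>a\<close>; in \<open>?R\<close> it acts at \<open>H a\<close>,
      after \<open>I\<mu>\<^sub>a\<close>.\<close>
  have L: "?L = E.elem_comp ?If ?Jg ?Kh
      (E.elem_comp ?If ?Ig ?Jg ?Ik (lam ?g)) (E.elem_comp ?Jg ?Jh ?Kh ?Jm (\<nu> ?h))"
    by (simp add: vertical_def horizontal_def functor_comp_def E.elem_comp_def[of ?If ?Jg]
        I.whisker_elem_comp[OF fgh(1,2) Jobj(2) k lg] J.whisker_elem_comp[OF fgh(2,3) Kobj(3) m n])
  have "?R = E.elem_comp ?If ?Ih ?Kh
      (D.elem_comp ?f ?g ?h (\<kappa> a) (\<mu> a) \<Zsemi>\<^bsub>V\<^esub> farr I ?f ?h)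
      (E.elem_comp ?Ih ?Jh ?Kh (lam ?h) (\<nu> ?h))"
    using I.whisker_elem_comp[OF fgh(1,3) Kobj(3) D.elem_comp_hom[OF fgh k m]
        E.elem_comp_hom[OF Iobj(3) Jobj(3) Kobj(3) lh n]]
    by (simp add: vertical_def horizontal_def E.elem_comp_def D.elem_comp_def)
  then have R: "?R = E.elem_comp ?If ?Ih ?Kh
      (E.elem_comp ?If ?Ig ?Ih ?Ik ?Im) (E.elem_comp ?Ih ?Jh ?Kh (lam ?h) (\<nu> ?h))"
    by (simp add: I.functor_elem_comp[OF fgh k m])
  have mid: "?mid \<in> hom\<^bsub>V\<^esub> (w \<otimes>\<^bsub>V\<^esub> v) (ehom E ?Ig ?Jh)"
    by (rule E.elem_comp_hom[OF Iobj(2,3) Jobj(3) Im lh])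
  have midn: "?midn \<in> hom\<^bsub>V\<^esub> ((w \<otimes>\<^bsub>V\<^esub> v) \<otimes>\<^bsub>V\<^esub> x) (ehom E ?Ig ?Kh)"
    by (rule E.elem_comp_hom[OF Iobj(2) Jobj(3) Kobj(3) mid n])
  have all: "?all \<in> hom\<^bsub>V\<^esub> (u \<otimes>\<^bsub>V\<^esub> ((w \<otimes>\<^bsub>V\<^esub> v) \<otimes>\<^bsub>V\<^esub> x)) (ehom E ?If ?Kh)"
    by (rule E.elem_comp_hom[OF Iobj(1,2) Kobj(3) Ik midn])
  have braid: "?braid \<in> hom\<^bsub>V\<^esub> ((v \<otimes>\<^bsub>V\<^esub> w) \<otimes>\<^bsub>V\<^esub> x) ((w \<otimes>\<^bsub>V\<^esub> v) \<otimes>\<^bsub>V\<^esub> x)"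
    by (rule V.tensor_hom V.braid_hom V.ident_hom grades)+
  have rebracket: "?rebracket p q
      \<in> hom\<^bsub>V\<^esub> ((u \<otimes>\<^bsub>V\<^esub> p) \<otimes>\<^bsub>V\<^esub> (q \<otimes>\<^bsub>V\<^esub> x)) (u \<otimes>\<^bsub>V\<^esub> ((p \<otimes>\<^bsub>V\<^esub> q) \<otimes>\<^bsub>V\<^esub> x))"
    if "p \<in> Obj V" "q \<in> Obj V" for p q
    by (rule V.seq_hom V.assoc_hom V.inv_assoc_hom V.tensor_hom V.ident_hom
        V.tensor_Obj grades that)+
  have ubraid: "\<one>\<^bsub>V\<^esub> u \<boxtimes>\<^bsub>V\<^esub> ?braid
      \<in> hom\<^bsub>V\<^esub> (u \<otimes>\<^bsub>V\<^esub> ((v \<otimes>\<^bsub>V\<^esub> w) \<otimes>\<^bsub>V\<^esub> x)) (u \<otimes>\<^bsub>V\<^esub> ((w \<otimes>\<^bsub>V\<^esub> v) \<otimes>\<^bsub>V\<^esub> x))"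
    by (rule V.tensor_hom[OF V.ident_hom[OF grades(1)] braid])
  have "?L = ?rebracket v w \<Zsemi>\<^bsub>V\<^esub> E.elem_comp ?If ?Ig ?Kh ?Ik
      (E.elem_comp ?Ig ?Jh ?Kh (E.elem_comp ?Ig ?Jg ?Jh (lam ?g) ?Jm) (\<nu> ?h))"
    unfolding L
    by (rule E.compose_middle_first[OF Iobj(1,2) Jobj(2,3) Kobj(3) Ik lg Jm n])
  also have "E.elem_comp ?Ig ?Jg ?Jh (lam ?g) ?Jm = \<beta>\<^bsub>V\<^esub> v w \<Zsemi>\<^bsub>V\<^esub> ?mid"
    by (rule lam.slide_past_component[OF fgh(2,3) m])
  also have "E.elem_comp ?Ig ?Jh ?Kh (\<beta>\<^bsub>V\<^esub> v w \<Zsemi>\<^bsub>V\<^esub> ?mid) (\<nu> ?h) = ?braid \<Zsemi>\<^bsub>V\<^esub> ?midn"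
    using E.elem_comp_precompose[OF Iobj(2) Jobj(3) Kobj(3) V.braid_hom[OF grades(2,3)]
        V.ident_hom[OF grades(4)] mid n] V.ident_seq[OF n] by simp
  also have "E.elem_comp ?If ?Ig ?Kh ?Ik (?braid \<Zsemi>\<^bsub>V\<^esub> ?midn)
      = (\<one>\<^bsub>V\<^esub> u \<boxtimes>\<^bsub>V\<^esub> ?braid) \<Zsemi>\<^bsub>V\<^esub> ?all"
    using E.elem_comp_precompose[OF Iobj(1,2) Kobj(3) V.ident_hom[OF grades(1)] braid Ik midn]
      V.ident_seq[OF Ik] by simp
  also have "?rebracket v w \<Zsemi>\<^bsub>V\<^esub> ((\<one>\<^bsub>V\<^esub> u \<boxtimes>\<^bsub>V\<^esub> ?braid) \<Zsemi>\<^bsub>V\<^esub> ?all)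
      = (?rebracket v w \<Zsemi>\<^bsub>V\<^esub> (\<one>\<^bsub>V\<^esub> u \<boxtimes>\<^bsub>V\<^esub> ?braid)) \<Zsemi>\<^bsub>V\<^esub> ?all"
    by (rule V.seq_assoc[OF rebracket[OF grades(2,3)] ubraid all, symmetric])
  \<comment> \<open>The grades \<open>v\<close> and \<open>w\<close> are now swapped in the rebracketing, as \<open>?R\<close> requires.\<close>
  also have "\<dots> = (mid_braid V u v w x \<Zsemi>\<^bsub>V\<^esub> ?rebracket w v) \<Zsemi>\<^bsub>V\<^esub> ?all"
    by (simp add: V.mid_braid_rebracket[OF grades])
  also have "\<dots> = mid_braid V u v w x \<Zsemi>\<^bsub>V\<^esub> (?rebracket w v \<Zsemi>\<^bsub>V\<^esub> ?all)"
    by (rule V.seq_assoc[OF V.mid_braid_hom[OF grades] rebracket[OF grades(3,2)] all])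
  also have "?rebracket w v \<Zsemi>\<^bsub>V\<^esub> ?all = ?R"
    unfolding R
    by (rule E.compose_middle_first[OF Iobj(1,2,3) Jobj(3) Kobj(3) Ik Im lh n, symmetric])
  finally have "?L = mid_braid V u v w x \<Zsemi>\<^bsub>V\<^esub> ?R" .
  moreover have "?L \<in> hom\<^bsub>V\<^esub> ((u \<otimes>\<^bsub>V\<^esub> v) \<otimes>\<^bsub>V\<^esub> (w \<otimes>\<^bsub>V\<^esub> x)) (ehom E ?If ?Kh)"
    unfolding L
    by (rule E.elem_comp_hom[OF Iobj(1) Jobj(2) Kobj(3)
          E.elem_comp_hom[OF Iobj(1,2) Jobj(2) Ik lg] E.elem_comp_hom[OF Jobj(2,3) Kobj(3) Jm n]])
  ultimately show ?thesis
    by blast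
qed

end
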